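(* Let $v,k,t$ be integers with $v>k>t\ge 2$. Let $X$ be a $v$-set and let $X=X_1\cup X_2$ be a partition of $X$ (so $X_1\cap X_2=\emptyset$) with $|X_1|=v_1$ and $|X_2|=v_2$. For $i=0,\dots,t$ let $D_i=(X_1,\mathcal{B}^{(i)})$ be the complete $i$-$(v_1,i,1)$ design, i.e. $\mathcal{B}^{(i)}$ is the set of all $i$-subsets of $X_1$; and for $i=t+1,\dots,k$ let $D_i=(X_1,\mathcal{B}^{(i)})$ be a simple $t$-$(v_1,i,\lambda^{(i)}_t)$ design. Similarly, for $i=0,\dots,t$ let $\bar D_i=(X_2,\bar{\mathcal{B}}^{(i)})$ be the complete $i$-$(v_2,i,1)$ design, and for $i=t+1,\dots,k$ let $\bar D_i=(X_2,\bar{\mathcal{B}}^{(i)})$ be a simple $t$-$(v_2,i,\bar\lambda^{(i)}_t)$ design. For $0\le s\le t$ and $0\le i\le k$, let $\lambda^{(i)}_s$ denote the number of blocks of $D_i$ containing a given $s$-subset of $X_1$, and $\bar\lambda^{(i)}_s$ the number of blocks of $\bar D_i$ containing a given $s$-subset of $X_2$ (these numbers do not depend on the chosen subset; they equal $0$ when $s>i$). For $i=0,\dots,k$ put $$\mathcal{B}_{(i,k-i)}=\{B_i\cup \bar B_{k-i}\;:\;B_i\in\mathcal{B}^{(i)},\ \bar B_{k-i}\in\bar{\mathcal{B}}^{(k-i)}\},$$ let $u_0,\dots,u_k\in\{0,1\}$, and define $$\mathcal{B}=\bigcup_{i\,:\,u_i=1}\mathcal{B}_{(i,k-i)}.$$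 For $s=0,\dots,t$ let $$L_{s,t-s}=\sum_{i=0}^k u_i\,\lambda^{(i)}_s\,\bar\lambda^{(k-i)}_{t-s}.$$ Assume that $$L_{0,t}=L_{1,t-1}=L_{2,t-2}=\cdots=L_{t,0}=\Lambda$$ for some positive integer $\Lambda$. Then $(X,\mathcal{B})$ is a simple $t$-$(v,k,\Lambda)$ design.
   Context: A $t$-$(v,k,\lambda)$ design is a pair $(X,\mathcal{B})$ where $X$ is a $v$-set of points and $\mathcal{B}$ is a collection (possibly a multiset) of $k$-subsets of $X$ (blocks) such that every $t$-subset of $X$ is contained in exactly $\lambda$ blocks. It is simple if no block is repeated. The complete $i$-$(w,i,1)$ design on a $w$-set consists of all $i$-subsets; by convention, for $i=0$ it has exactly one block, the empty set, and when $w=i$ it has exactly one block consisting of all $w$ points. *)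

theory Defs
  imports Main "HOL-Library.Multiset"
begin

text \<open>
  Blocks form a multiset, so that repeated blocks are possible in general and being simple is
  a genuine condition. Degenerate parameters (\<open>v < k\<close>, \<open>\<Lambda> = 0\<close>) are not excluded.
\<close>

definition t_design :: "nat \<Rightarrow> nat \<Rightarrow> nat \<Rightarrow> nat \<Rightarrow> 'a set \<Rightarrow> 'a set multiset \<Rightarrow> bool" where
  "t_design t v k \<Lambda> X \<B> \<longleftrightarrow>
     finite X \<and> card X = v \<and>
     (\<forall>B \<in># \<B>. B \<subseteq> X \<and> card B = k) \<and>
     (\<forall>T. T \<subseteq> X \<and> card T = t \<longrightarrow> size {#B \<in># \<B>. T \<subseteq> B#} = \<Lambda>)"

definition simple_blocks :: "'a set multiset \<Rightarrow> bool" where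
  "simple_blocks \<B> \<longleftrightarrow> (\<forall>B. count \<B> B \<le> 1)"

definition simple_t_design :: "nat \<Rightarrow> nat \<Rightarrow> nat \<Rightarrow> nat \<Rightarrow> 'a set \<Rightarrow> 'a set multiset \<Rightarrow> bool" where
  "simple_t_design t v k \<Lambda> X \<B> \<longleftrightarrow> t_design t v k \<Lambda> X \<B> \<and> simple_blocks \<B>"

text \<open>For \<open>i = 0\<close> the only block is the empty set; for \<open>i > card X\<close> there are no blocks.\<close>

definition complete_blocks :: "nat \<Rightarrow> 'a set \<Rightarrow> 'a set multiset" where
  "complete_blocks i X = mset_set {B. B \<subseteq> X \<and> card B = i}"

text \<open>
  The number of blocks containing a given \<open>s\<close>-subset of \<open>X\<close>, to be used when this number is
  the same for all \<open>s\<close>-subsets. If \<open>X\<close> has no \<open>s\<close>-subset at all, the number is \<open>0\<close> by convention.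
\<close>

definition cover_number :: "'a set \<Rightarrow> 'a set multiset \<Rightarrow> nat \<Rightarrow> nat" where
  "cover_number X \<B> s =
     (if s \<le> card X
      then (THE n. \<forall>S. S \<subseteq> X \<and> card S = s \<longrightarrow> size {#B \<in># \<B>. S \<subseteq> B#} = n)
      else 0)"

definition joined_blocks :: "'a set multiset \<Rightarrow> 'a set multiset \<Rightarrow> 'a set set" where
  "joined_blocks \<B> \<C> = {B \<union> C | B C. B \<in># \<B> \<and> C \<in># \<C>}"

end

theory Submission imports Defs "HOL-Library.FuncSet" begin

text \<open>
  A \<open>t\<close>-subset \<open>T\<close> of \<open>X\<close> that meets \<open>X1\<close> in \<open>s\<close> points meets \<open>X2\<close> in \<open>t - s\<close> points, and a
  block \<open>B \<union> C\<close> contains \<open>T\<close> iff \<open>B\<close> contains \<open>T \<inter> X1\<close> and \<open>C\<close> contains \<open>T \<inter> X2\<close>. Each block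
  determines \<open>i\<close>, \<open>B\<close> and \<open>C\<close> by its intersections with \<open>X1\<close> and \<open>X2\<close>, so the number of blocks
  through \<open>T\<close> is \<open>L\<^bsub>s,t-s\<^esub>\<close>. This needs that the number of blocks of an ingredient through an
  \<open>s\<close>-set depends on \<open>s\<close> only, which follows by double counting.
\<close>

text \<open>Adding and removing \<open>S\<close> are mutually inverse, so only the choice of
  \<open>n - card S\<close> further points in \<open>Y - S\<close> remains. Without
  \<open>card S \<le> n\<close> truncated subtraction would give the value 1 for an empty
  family.\<close>

lemma card_supersets:
  assumes "finite Y" and "S \<subseteq> Y" and "card S \<le> n"
  shows "card {T. S \<subseteq> T \<and> T \<subseteq> Y \<and> card T = n} = (card Y - card S) choose (n - card S)"
proof -
  have finS: "finite S" using assms by (auto intro: finite_subset)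
  have "bij_betw (\<lambda>U. U \<union> S) {U. U \<subseteq> Y - S \<and> card U = n - card S}
          {T. S \<subseteq> T \<and> T \<subseteq> Y \<and> card T = n}"
  proof (rule bij_betwI[where g = "\<lambda>T. T - S"])
    show "(\<lambda>U. U \<union> S) \<in> {U. U \<subseteq> Y - S \<and> card U = n - card S} \<rightarrow> {T. S \<subseteq> T \<and> T \<subseteq> Y \<and> card T = n}"
    proof
      fix U assume U: "U \<in> {U. U \<subseteq> Y - S \<and> card U = n - card S}"
      then have "finite U" using assms(1) by (auto intro: finite_subset)
      with U have "card (U \<union> S) = card U + card S"
        using finS by (intro card_Un_disjoint) auto
      with U assms show "U \<union> S \<in> {T. S \<subseteq> T \<and> T \<subseteq> Y \<and> card T = n}" by auto
    qed
    show "(\<lambda>T. T - S) \<in> {T. S \<subseteq> T \<and> T \<subseteq> Y \<and> card T = n} \<rightarrow> {U. U \<subseteq> Y - S \<and> card U = n - card S}"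
      using finS by (auto simp: card_Diff_subset)
  qed auto
  then have "card {T. S \<subseteq> T \<and> T \<subseteq> Y \<and> card T = n} = card {U. U \<subseteq> Y - S \<and> card U = n - card S}"
    by (rule bij_betw_same_card[symmetric])
  also have "\<dots> = (card Y - card S) choose (n - card S)"
    using assms finS by (simp add: n_subsets card_Diff_subset)
  finally show ?thesis .
qed

lemma size_filter_complete_blocks:
  assumes "finite Y" and "S \<subseteq> Y"
  shows "size {#B \<in># complete_blocks i Y. S \<subseteq> B#}
           = (if card S \<le> i then (card Y - card S) choose (i - card S) else 0)"
proof -
  have eq: "{B \<in> {B. B \<subseteq> Y \<and> card B = i}. S \<subseteq> B} = {B. S \<subseteq> B \<and> B \<subseteq> Y \<and> card B = i}" by auto
  show ?thesis
  proof (cases "card S \<le> i")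
    case True
    then show ?thesis using assms by (simp add: complete_blocks_def eq[simplified] card_supersets)
  next
    case False
    then have "{B. S \<subseteq> B \<and> B \<subseteq> Y \<and> card B = i} = {}"
      using assms(1) by (auto dest: card_mono[rotated] finite_subset)
    then show ?thesis using assms False by (simp add: complete_blocks_def eq[simplified])
  qed
qed

text \<open>Both sides count the pairs \<open>T \<subseteq> B\<close>, each block taken with its
  multiplicity.\<close>

lemma sum_size_filter_subset_mset:
  assumes "finite \<T>"
  shows "(\<Sum>T\<in>\<T>. size {#B \<in># \<B>. T \<subseteq> B#}) = (\<Sum>B\<in>#\<B>. card {T \<in> \<T>. T \<subseteq> B})"
proof (induction \<B>)
  case (add B \<B>)
  have "(\<Sum>T\<in>\<T>. size {#B' \<in># add_mset B \<B>. T \<subseteq> B'#})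
          = (\<Sum>T\<in>\<T>. (if T \<subseteq> B then 1 else 0) + size {#B' \<in># \<B>. T \<subseteq> B'#})"
    by (intro sum.cong) auto
  also have "\<dots> = card {T \<in> \<T>. T \<subseteq> B} + (\<Sum>T\<in>\<T>. size {#B' \<in># \<B>. T \<subseteq> B'#})"
    using assms by (simp add: sum.distrib sum.If_cases Int_def)
  finally show ?case using add by simp
qed simp

text \<open>Double counting of the pairs \<open>(T, B)\<close> with
  \<open>S \<subseteq> T \<subseteq> B\<close> and \<open>card T = t\<close>: summing over
  \<open>T\<close> gives the right-hand side, summing over \<open>B\<close> the left-hand one. The
  product form avoids division in \<open>nat\<close>.\<close>

lemma t_design_size_filter_mult:
  assumes "t_design t v k \<Lambda> Y \<B>" and "S \<subseteq> Y" and "card S \<le> t"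
  shows "size {#B \<in># \<B>. S \<subseteq> B#} * ((k - card S) choose (t - card S))
           = ((v - card S) choose (t - card S)) * \<Lambda>"
proof -
  have Y: "finite Y" "card Y = v"
    and blocks: "\<And>B. B \<in># \<B> \<Longrightarrow> B \<subseteq> Y \<and> card B = k"
    and bal: "\<And>T. T \<subseteq> Y \<Longrightarrow> card T = t \<Longrightarrow> size {#B \<in># \<B>. T \<subseteq> B#} = \<Lambda>"
    using assms(1) by (auto simp: t_design_def)
  define \<T> where "\<T> = {T. S \<subseteq> T \<and> T \<subseteq> Y \<and> card T = t}"
  have fin: "finite \<T>" using Y by (auto simp: \<T>_def)
  have card_below: "card {T \<in> \<T>. T \<subseteq> B}
      = (if S \<subseteq> B then (k - card S) choose (t - card S) else 0)" if "B \<in># \<B>" for B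
  proof (cases "S \<subseteq> B")
    case True
    have "{T \<in> \<T>. T \<subseteq> B} = {T. S \<subseteq> T \<and> T \<subseteq> B \<and> card T = t}"
      using blocks[OF that] by (auto simp: \<T>_def)
    then show ?thesis
      using True blocks[OF that] Y assms(3) by (auto simp: card_supersets finite_subset)
  next
    case False
    then have "{T \<in> \<T>. T \<subseteq> B} = {}" by (auto simp: \<T>_def)
    then show ?thesis by (simp only: False if_False card.empty)
  qed
  have "((v - card S) choose (t - card S)) * \<Lambda> = (\<Sum>T\<in>\<T>. size {#B \<in># \<B>. T \<subseteq> B#})"
    using assms Y by (simp add: \<T>_def bal card_supersets)
  also have "\<dots> = (\<Sum>B\<in>#\<B>. card {T \<in> \<T>. T \<subseteq> B})"
    using fin by (rule sum_size_filter_subset_mset)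
  also have "\<dots> = (\<Sum>B\<in>#\<B>. if S \<subseteq> B then (k - card S) choose (t - card S) else 0)"
    using card_below by (intro arg_cong[of _ _ sum_mset] image_mset_cong) auto
  also have "\<dots> = size {#B \<in># \<B>. S \<subseteq> B#} * ((k - card S) choose (t - card S))"
    by (induction \<B>) auto
  finally show ?thesis by simp
qed

text \<open>The set \<open>S\<close> serves as a witness: it shows that the default value 0 of
  \<open>cover_number\<close> does not apply, and that the described number is unique.\<close>

lemma cover_number_eqI:
  assumes "finite Y" and "S \<subseteq> Y"
    and "\<And>S'. S' \<subseteq> Y \<Longrightarrow> card S' = card S \<Longrightarrow> size {#B \<in># \<B>. S' \<subseteq> B#} = n"
  shows "cover_number Y \<B> (card S) = n"
proof -
  have "card S \<le> card Y" using assms by (simp add: card_mono)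
  moreover have "(THE n. \<forall>S'. S' \<subseteq> Y \<and> card S' = card S \<longrightarrow> size {#B \<in># \<B>. S' \<subseteq> B#} = n) = n"
    using assms by (intro the_equality) auto
  ultimately show ?thesis by (simp add: cover_number_def)
qed

lemma cover_number_complete_blocks:
  assumes "finite Y" and "S \<subseteq> Y"
  shows "cover_number Y (complete_blocks i Y) (card S) = size {#B \<in># complete_blocks i Y. S \<subseteq> B#}"
  using assms by (intro cover_number_eqI) (simp_all add: size_filter_complete_blocks)

lemma cover_number_t_design:
  assumes "t_design t v k \<Lambda> Y \<B>" and "S \<subseteq> Y" and "card S \<le> t" and "t \<le> k"
  shows "cover_number Y \<B> (card S) = size {#B \<in># \<B>. S \<subseteq> B#}"
proof (rule cover_number_eqI)
  show "finite Y" using assms(1) by (simp add: t_design_def)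
  fix S' assume S': "S' \<subseteq> Y" "card S' = card S"
  have "size {#B \<in># \<B>. S' \<subseteq> B#} * ((k - card S) choose (t - card S))
          = size {#B \<in># \<B>. S \<subseteq> B#} * ((k - card S) choose (t - card S))"
    using t_design_size_filter_mult[OF assms(1) S'(1)] t_design_size_filter_mult[OF assms(1,2)]
      assms S' by simp
  \<comment> \<open>Here \<open>t \<le> k\<close> enters: the factor common to both counts is
    positive and can be cancelled.\<close>
  moreover have "0 < (k - card S) choose (t - card S)" using assms by simp
  ultimately show "size {#B \<in># \<B>. S' \<subseteq> B#} = size {#B \<in># \<B>. S \<subseteq> B#}" by simp
qed (fact assms(2))

text \<open>A simple block multiset is the \<open>mset_set\<close> of its support. This turns the
  sizes used for designs into cardinalities, which suit \<open>joined_blocks\<close>, a set.\<close>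

lemma simple_blocks_size_filter:
  assumes "simple_blocks \<B>"
  shows "size (filter_mset P \<B>) = card {B \<in> set_mset \<B>. P B}"
proof -
  have "\<B> = mset_set (set_mset \<B>)"
  proof (rule multiset_eqI)
    fix B
    show "count \<B> B = count (mset_set (set_mset \<B>)) B"
      using assms[unfolded simple_blocks_def, rule_format, of B]
      by (cases "B \<in># \<B>") (auto simp: count_mset_set' not_in_iff le_Suc_eq simp flip: count_greater_zero_iff)
  qed
  then have "size (filter_mset P \<B>) = size (filter_mset P (mset_set (set_mset \<B>)))" by simp
  then show ?thesis by simp
qed

lemma simple_blocks_mset_set: "simple_blocks (mset_set A)"
  by (simp add: simple_blocks_def count_mset_set')

text \<open>A common interface to both kinds of ingredients, so that the cases
  \<open>i \<le> t\<close> and \<open>t < i\<close> need not be separated later.\<close>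

lemma ingredient_blocks:
  assumes "finite Y"
    and complete: "i \<le> t \<Longrightarrow> \<B> = complete_blocks i Y"
    and design: "t < i \<Longrightarrow> simple_t_design t w i \<Lambda> Y \<B>"
  shows "\<And>B. B \<in># \<B> \<Longrightarrow> B \<subseteq> Y \<and> card B = i"
    and "\<And>S. S \<subseteq> Y \<Longrightarrow> card S \<le> t
          \<Longrightarrow> card {B \<in> set_mset \<B>. S \<subseteq> B} = cover_number Y \<B> (card S)"
proof -
  show "B \<subseteq> Y \<and> card B = i" if "B \<in># \<B>" for B
    using that assms
    by (cases "i \<le> t") (auto simp: complete_blocks_def simple_t_design_def t_design_def)
  fix S assume S: "S \<subseteq> Y" "card S \<le> t"
  have "simple_blocks \<B>"
    using complete design by (cases "i \<le> t")
      (auto simp: complete_blocks_def simple_t_design_def simple_blocks_mset_set)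
  moreover have "cover_number Y \<B> (card S) = size {#B \<in># \<B>. S \<subseteq> B#}"
  proof (cases "i \<le> t")
    case True
    then show ?thesis using S assms(1) complete by (simp add: cover_number_complete_blocks)
  next
    case False
    then show ?thesis
      using S design cover_number_t_design[of t w i \<Lambda> Y \<B> S] by (simp add: simple_t_design_def)
  qed
  ultimately show "card {B \<in> set_mset \<B>. S \<subseteq> B} = cover_number Y \<B> (card S)"
    by (simp add: simple_blocks_size_filter)
qed

lemma joined_blocks_image:
  "joined_blocks \<B> \<C> = (\<lambda>(B, C). B \<union> C) ` (set_mset \<B> \<times> set_mset \<C>)"
  by (auto simp: joined_blocks_def)

text \<open>The condition on \<open>B \<union> C\<close> splits into independent conditions on
  \<open>B\<close> and \<open>C\<close>, and the pair is recovered from the union by intersecting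
  with \<open>Y\<close> and \<open>Z\<close>; hence the count is a product.\<close>

lemma card_joined_blocks_filter:
  assumes "Y \<inter> Z = {}" and "T \<subseteq> Y \<union> Z"
    and "\<And>B. B \<in># \<B> \<Longrightarrow> B \<subseteq> Y" and "\<And>C. C \<in># \<C> \<Longrightarrow> C \<subseteq> Z"
  shows "card {A \<in> joined_blocks \<B> \<C>. T \<subseteq> A}
           = card {B \<in> set_mset \<B>. T \<inter> Y \<subseteq> B} * card {C \<in> set_mset \<C>. T \<inter> Z \<subseteq> C}"
proof -
  let ?P = "{B \<in> set_mset \<B>. T \<inter> Y \<subseteq> B} \<times> {C \<in> set_mset \<C>. T \<inter> Z \<subseteq> C}"
  have sub: "T \<subseteq> B \<union> C \<longleftrightarrow> T \<inter> Y \<subseteq> B \<and> T \<inter> Z \<subseteq> C" if "B \<in># \<B>" "C \<in># \<C>" for B C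
    using assms(1,2) assms(3)[OF that(1)] assms(4)[OF that(2)] by blast
  have "{A \<in> joined_blocks \<B> \<C>. T \<subseteq> A} = (\<lambda>(B, C). B \<union> C) ` ?P"
    using sub by (fastforce simp: joined_blocks_image)
  moreover have "inj_on (\<lambda>(B, C). B \<union> C) ?P"
  proof (rule inj_on_inverseI[where g = "\<lambda>A. (A \<inter> Y, A \<inter> Z)"])
    fix p assume "p \<in> ?P"
    then obtain B C where p: "p = (B, C)" "B \<in># \<B>" "C \<in># \<C>" by auto
    show "((case p of (B, C) \<Rightarrow> B \<union> C) \<inter> Y, (case p of (B, C) \<Rightarrow> B \<union> C) \<inter> Z) = p"
      using p assms(1) assms(3)[OF p(2)] assms(4)[OF p(3)] by auto
  qed
  ultimately show ?thesis by (simp add: card_image card_cartesian_product)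
qed

theorem theorem1:
  fixes v k t v1 v2 \<Lambda> :: nat
    and X X1 X2 :: "'a set"
    and D1 D2 :: "nat \<Rightarrow> 'a set multiset"
    and lam1 lam2 :: "nat \<Rightarrow> nat \<Rightarrow> nat"
    and u :: "nat \<Rightarrow> nat"
  assumes "k < v" and "t < k" and "2 \<le> t"
    and "finite X" and "card X = v"
    and "X = X1 \<union> X2" and "X1 \<inter> X2 = {}"
    and "card X1 = v1" and "card X2 = v2"
    and "\<And>i s. i \<le> k \<Longrightarrow> s \<le> t \<Longrightarrow> lam1 i s = cover_number X1 (D1 i) s"
    and "\<And>i s. i \<le> k \<Longrightarrow> s \<le> t \<Longrightarrow> lam2 i s = cover_number X2 (D2 i) s"
    and "\<And>i. i \<le> t \<Longrightarrow> D1 i = complete_blocks i X1"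
    and "\<And>i. t < i \<Longrightarrow> i \<le> k \<Longrightarrow> simple_t_design t v1 i (lam1 i t) X1 (D1 i)"
    and "\<And>i. i \<le> t \<Longrightarrow> D2 i = complete_blocks i X2"
    and "\<And>i. t < i \<Longrightarrow> i \<le> k \<Longrightarrow> simple_t_design t v2 i (lam2 i t) X2 (D2 i)"
    and "\<And>i. i \<le> k \<Longrightarrow> u i \<in> {0, 1}"
    and "0 < \<Lambda>"
    and "\<And>s. s \<le> t \<Longrightarrow> (\<Sum>i=0..k. u i * lam1 i s * lam2 (k - i) (t - s)) = \<Lambda>"
  shows "simple_t_design t v k \<Lambda> X
           (mset_set (\<Union>i \<in> {i. i \<le> k \<and> u i = 1}. joined_blocks (D1 i) (D2 (k - i))))"
proof -
  note X = assms(4-9) and lam1 = assms(10) and lam2 = assms(11)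
    and u = assms(16) and L = assms(18)
  have fin1: "finite X1" and fin2: "finite X2" using X by auto
  note blocks1 = ingredient_blocks[OF fin1 assms(12) assms(13)]
  note blocks2 = ingredient_blocks[OF fin2 assms(14) assms(15)]
  define J where "J i = joined_blocks (D1 i) (D2 (k - i))" for i
  define I where "I = {i. i \<le> k \<and> u i = 1}"
  have finI: "finite I" by (simp add: I_def)
  \<comment> \<open>Finiteness matters because \<open>mset_set\<close> of an infinite set is
    empty.\<close>
  have finJ: "finite (J i)" for i by (simp add: J_def joined_blocks_image)
  \<comment> \<open>The last conjunct lets a block determine its index, so the families
    \<open>J i\<close> are pairwise disjoint.\<close>
  have J: "A \<subseteq> X \<and> card A = k \<and> card (A \<inter> X1) = i" if "A \<in> J i" "i \<le> k" for A i
  proof -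
    from that obtain B C where A: "A = B \<union> C" "B \<in># D1 i" "C \<in># D2 (k - i)"
      by (auto simp: J_def joined_blocks_def)
    have B: "B \<subseteq> X1" "card B = i" using blocks1(1)[of i] A that by auto
    have C: "C \<subseteq> X2" "card C = k - i" using blocks2(1)[of "k - i"] A that by auto
    have "card A = card B + card C"
      unfolding A using B C X fin1 fin2 by (intro card_Un_disjoint) (auto intro: finite_subset)
    moreover have "A \<inter> X1 = B" using A B C X by auto
    ultimately show ?thesis using A B C X that by auto
  qed
  have "size {#A \<in># mset_set (\<Union>i\<in>I. J i). T \<subseteq> A#} = \<Lambda>" if T: "T \<subseteq> X" "card T = t" for T
  proof -
    define s where "s = card (T \<inter> X1)"
    have "card (T \<inter> X1) + card (T \<inter> X2) = card ((T \<inter> X1) \<union> (T \<inter> X2))"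
      using X fin1 fin2 by (intro card_Un_disjoint[symmetric]) auto
    also have "(T \<inter> X1) \<union> (T \<inter> X2) = T" using T X by auto
    finally have s: "s \<le> t" "card (T \<inter> X2) = t - s" using T by (auto simp: s_def)
    have J_through: "card {A \<in> J i. T \<subseteq> A} = lam1 i s * lam2 (k - i) (t - s)" if i: "i \<le> k" for i
    proof -
      have "card {A \<in> J i. T \<subseteq> A}
          = card {B \<in> set_mset (D1 i). T \<inter> X1 \<subseteq> B} * card {C \<in> set_mset (D2 (k - i)). T \<inter> X2 \<subseteq> C}"
        unfolding J_def using X T i blocks1(1)[of i] blocks2(1)[of "k - i"]
        by (intro card_joined_blocks_filter) auto
      also have "card {B \<in> set_mset (D1 i). T \<inter> X1 \<subseteq> B} = lam1 i s"
        using blocks1(2)[of i "T \<inter> X1"] lam1[of i s] i s by (simp add: s_def)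
      also have "card {C \<in> set_mset (D2 (k - i)). T \<inter> X2 \<subseteq> C} = lam2 (k - i) (t - s)"
        using blocks2(2)[of "k - i" "T \<inter> X2"] lam2[of "k - i" "t - s"] i s by simp
      finally show ?thesis .
    qed
    have "size {#A \<in># mset_set (\<Union>i\<in>I. J i). T \<subseteq> A#} = card (\<Union>i\<in>I. {A \<in> J i. T \<subseteq> A})"
      using finI finJ by (simp, intro arg_cong[of _ _ card]) auto
    also have "\<dots> = (\<Sum>i\<in>I. card {A \<in> J i. T \<subseteq> A})"
    proof (rule card_UN_disjoint)
      \<comment> \<open>A common block \<open>A\<close> would force
        \<open>i = card (A \<inter> X1) = j\<close>.\<close>
      show "\<forall>i\<in>I. \<forall>j\<in>I. i \<noteq> j \<longrightarrow> {A \<in> J i. T \<subseteq> A} \<inter> {A \<in> J j. T \<subseteq> A} = {}"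
        using J unfolding I_def by blast
    qed (use finI finJ in auto)
    \<comment> \<open>On \<open>I\<close> the inserted factor \<open>u i\<close> is 1; at the other
      indices up to \<open>k\<close> it is 0, so the sum then extends to
      \<open>0..k\<close>.\<close>
    also have "\<dots> = (\<Sum>i\<in>I. u i * lam1 i s * lam2 (k - i) (t - s))"
      by (intro sum.cong) (auto simp: I_def J_through)
    also have "\<dots> = (\<Sum>i=0..k. u i * lam1 i s * lam2 (k - i) (t - s))"
      using u by (intro sum.mono_neutral_left) (fastforce simp: I_def)+
    also have "\<dots> = \<Lambda>" using s by (intro L)
    finally show ?thesis .
  qed
  moreover have "A \<subseteq> X \<and> card A = k" if "A \<in># mset_set (\<Union>i\<in>I. J i)" for A
  proof -
    from that obtain i where "A \<in> J i" "i \<le> k" using finI finJ by (auto simp: I_def)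
    then show ?thesis using J by blast
  qed
  ultimately have "t_design t v k \<Lambda> X (mset_set (\<Union>i\<in>I. J i))"
    using X by (simp add: t_design_def)
  \<comment> \<open>Simplicity is immediate, since the blocks are the \<open>mset_set\<close> of a
    set.\<close>
  then show ?thesis
    by (simp add: simple_t_design_def simple_blocks_mset_set I_def J_def)
qed

end
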